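(* Let $B$ be a compact Hausdorff space and let $R:C(B)\to C(B)$ be a positive linear operator with $R1=1$. For $\mu\in\mathcal{M}_1(B)$ let $\Sigma^{(\mu)}$ be the induced measure on $\Omega=B^{\mathbb{N}}$. If some continuous onto map $r:B\to B$ satisfies $$R((\varphi\circ r)\psi)=\varphi R(\psi)\qquad(\varphi,\psi\in C(B)),$$ then for every $\mu\in\mathcal{M}_1(B)$ the measure $\Sigma^{(\mu)}$ has its support contained in the solenoid $\mathrm{Sol}(r)$.
   Context: $\mathbb{N}=\{1,2,\dots\}$; $C(B)$ is the space of continuous functions $B\to\mathbb{R}$; $\mathcal{M}_1(B)$ is the set of (regular) Borel probability measures on $B$; $R$ is positive if $\varphi\ge0$ implies $R\varphi\ge0$; $M_\varphi f=\varphi f$. For $x\in B$, $\mathbb{P}_x=\mathbb{P}_x^{(R)}$ denotes the unique regular Borel probability measure on $B^{\mathbb{N}}$ with $\int\varphi_1(x_1)\cdots\varphi_n(x_n)\,d\mathbb{P}_x(\tilde x)=(M_{\varphi_1}RM_{\varphi_2}\cdots RM_{\varphi_n}1)(x)$ for all $n$ and $\varphi_i\in C(B)$; it is carried by $\pi_1^{-1}(x)=\{\tilde x: x_1=x\}$. The induced measure is $\int f\,d\Sigma^{(\mu)}=\int_B\int_{\pi_1^{-1}(x)}f\,d\mathbb{P}_x\,d\mu(x)$. The solenoid is $\mathrm{Sol}(r)=\{(x_1,x_2,\dots)\in B^{\mathbb{N}}: r(x_{i+1})=x_i,\ i=1,2,\dots\}$. *)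

theory Defs
  imports "HOL-Probability.Probability"
begin

text \<open>The compact Hausdorff space \<open>B\<close> is a type of class \<open>t2_space\<close> whose universe is compact.
  \<open>B\<^sup>\<nat>\<close> is the type \<open>nat \<Rightarrow> 'a\<close> with its product topology; indices start at \<open>0\<close>, so the
  coordinate \<open>x\<^sub>i\<close> of the literature is \<open>\<omega> (i - 1)\<close>. As \<open>B\<close> need not be second countable, measures
  on \<open>B\<^sup>\<nat>\<close> live on the Borel sets of the product topology, not on the product sigma-algebra.\<close>

definition C :: "('b::topological_space \<Rightarrow> real) set" where
  "C = {\<phi>. continuous_on UNIV \<phi>}"

text \<open>An operator on \<open>C(B)\<close> is a function on all of \<open>'b \<Rightarrow> real\<close> of which only the restriction
  to \<open>C\<close> matters.\<close>

definition linear_operator :: "(('b::topological_space \<Rightarrow> real) \<Rightarrow> ('b \<Rightarrow> real)) \<Rightarrow> bool" where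
  "linear_operator R \<longleftrightarrow>
     (\<forall>\<phi>\<in>C. R \<phi> \<in> C) \<and>
     (\<forall>\<phi>\<in>C. \<forall>\<psi>\<in>C. R (\<lambda>x. \<phi> x + \<psi> x) = (\<lambda>x. R \<phi> x + R \<psi> x)) \<and>
     (\<forall>c. \<forall>\<phi>\<in>C. R (\<lambda>x. c * \<phi> x) = (\<lambda>x. c * R \<phi> x))"

definition positive_operator :: "(('b::topological_space \<Rightarrow> real) \<Rightarrow> ('b \<Rightarrow> real)) \<Rightarrow> bool" where
  "positive_operator R \<longleftrightarrow> (\<forall>\<phi>\<in>C. (\<forall>x. 0 \<le> \<phi> x) \<longrightarrow> (\<forall>x. 0 \<le> R \<phi> x))"

definition mult_op :: "('b \<Rightarrow> real) \<Rightarrow> ('b \<Rightarrow> real) \<Rightarrow> ('b \<Rightarrow> real)" where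
  "mult_op \<phi> f = (\<lambda>x. \<phi> x * f x)"

definition regular_borel_prob :: "'b::topological_space measure \<Rightarrow> bool" where
  "regular_borel_prob M \<longleftrightarrow>
     prob_space M \<and> sets M = sets borel \<and>
     (\<forall>A\<in>sets borel.
        emeasure M A = (INF U\<in>{U. A \<subseteq> U \<and> open U}. emeasure M U) \<and>
        emeasure M A = (SUP K\<in>{K. K \<subseteq> A \<and> compact K}. emeasure M K))"

text \<open>\<open>chain R [\<phi>\<^sub>1, \<dots>, \<phi>\<^sub>n]\<close> is \<open>M\<^bsub>\<phi>\<^sub>1\<^esub> R M\<^bsub>\<phi>\<^sub>2\<^esub> \<cdots> R M\<^bsub>\<phi>\<^sub>n\<^esub> 1\<close>; it is used for \<open>n \<ge> 1\<close> only.\<close>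

fun chain :: "(('b \<Rightarrow> real) \<Rightarrow> ('b \<Rightarrow> real)) \<Rightarrow> ('b \<Rightarrow> real) list \<Rightarrow> ('b \<Rightarrow> real)" where
  "chain R [] = (\<lambda>_. 1)"
| "chain R [\<phi>] = mult_op \<phi> (\<lambda>_. 1)"
| "chain R (\<phi> # \<psi> # \<phi>s) = mult_op \<phi> (R (chain R (\<psi> # \<phi>s)))"

text \<open>The property that characterises \<open>\<P>\<^sub>x\<^sup>(\<^sup>R\<^sup>)\<close> uniquely among the Borel measures on \<open>B\<^sup>\<nat>\<close>.\<close>

definition is_path_measure ::
    "(('b::topological_space \<Rightarrow> real) \<Rightarrow> ('b \<Rightarrow> real)) \<Rightarrow> 'b \<Rightarrow> (nat \<Rightarrow> 'b) measure \<Rightarrow> bool" where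
  "is_path_measure R x P \<longleftrightarrow>
     regular_borel_prob P \<and>
     (\<forall>\<phi>s. \<phi>s \<noteq> [] \<and> set \<phi>s \<subseteq> C \<longrightarrow>
        (LINT \<omega>|P. (\<Prod>i<length \<phi>s. (\<phi>s ! i) (\<omega> i))) = chain R \<phi>s x)"

text \<open>The property that characterises \<open>\<Sigma>\<^sup>(\<^sup>\<mu>\<^sup>)\<close> uniquely. For continuous \<open>f\<close> and path measures \<open>P x\<close> the
  outer integrand is continuous in \<open>x\<close> (Stone--Weierstrass), so the outer integral is meaningful.\<close>

definition is_induced_measure ::
    "('b::topological_space \<Rightarrow> (nat \<Rightarrow> 'b) measure) \<Rightarrow> 'b measure \<Rightarrow> (nat \<Rightarrow> 'b) measure \<Rightarrow> bool" where
  "is_induced_measure P \<mu> S \<longleftrightarrow>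
     regular_borel_prob S \<and>
     (\<forall>f\<in>C. (LINT \<omega>|S. f \<omega>) = (LINT x|\<mu>. (LINT \<omega>:{\<omega>. \<omega> 0 = x}|P x. f \<omega>)))"

definition measure_support :: "'b::topological_space measure \<Rightarrow> 'b set" where
  "measure_support M = {x. \<forall>U. open U \<and> x \<in> U \<longrightarrow> emeasure M U > 0}"

definition Sol :: "('b \<Rightarrow> 'b) \<Rightarrow> (nat \<Rightarrow> 'b) set" where
  "Sol r = {\<omega>. \<forall>i. r (\<omega> (Suc i)) = \<omega> i}"

end

theory Submission
  imports Defs
begin

text \<open>If \<open>\<phi>\<close> is continuous, then the integrals of \<open>\<phi> (x\<^sub>i)\<^sup>2\<close>, \<open>\<phi> (x\<^sub>i) * \<phi> (r (x\<^sub>i\<^sub>+\<^sub>1))\<close> and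
  \<open>\<phi> (r (x\<^sub>i\<^sub>+\<^sub>1))\<^sup>2\<close> against \<open>P x\<close> all equal \<open>R\<^sup>i (\<phi>\<^sup>2) x\<close>, since \<open>R (\<phi> \<circ> r) = \<phi>\<close>. Hence
  \<open>(\<phi> (x\<^sub>i) - \<phi> (r (x\<^sub>i\<^sub>+\<^sub>1)))\<^sup>2\<close> has integral \<open>0\<close> for each \<open>P x\<close>, and so for the induced measure. By
  Urysohn's lemma, such continuous functions detect every point outside the solenoid.\<close>

text \<open>Compact Hausdorff spaces are normal, so Urysohn's lemma applies to the two disjoint
  closed singletons.\<close>

lemma compact_t2_separating_function:
  fixes a b :: "'a::t2_space"
  assumes "compact (UNIV :: 'a set)" and "a \<noteq> b"
  obtains \<phi> :: "'a \<Rightarrow> real" where "continuous_on UNIV \<phi>" "\<phi> a \<noteq> \<phi> b"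
proof -
  have "Hausdorff_space (euclidean :: 'a topology)"
    using hausdorff by (fastforce simp: Hausdorff_space_def disjnt_def)
  moreover have "compact_space (euclidean :: 'a topology)"
    using assms(1) by (simp add: compact_space_def compactin_euclidean_iff)
  ultimately have "normal_space (euclidean :: 'a topology)"
    by (simp add: compact_Hausdorff_or_regular_imp_normal_space)
  then obtain \<phi> where "continuous_map (euclidean :: 'a topology) (top_of_set {0..1::real}) \<phi>"
      and "\<phi> ` {a} \<subseteq> {0}" "\<phi> ` {b} \<subseteq> {1}"
    using Urysohn_lemma[of euclidean "{a}" "{b}" 0 1] assms(2) by (auto simp: disjnt_def)
  then show thesis
    by (intro that[of \<phi>]) (auto simp: continuous_map_in_subtopology)
qed

lemma compact_UNIV_continuous_bounded:
  fixes f :: "'a::topological_space \<Rightarrow> real"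
  assumes "compact (UNIV :: 'a set)" and "continuous_on UNIV f"
  obtains K where "\<And>x. \<bar>f x\<bar> \<le> K"
  using compact_imp_bounded[OF compact_continuous_image[OF assms(2,1)]]
  by (auto simp: bounded_iff)

text \<open>The defining identity of a path measure involves all coordinates from \<open>0\<close>
  on; padding with the constant 1 leaves only the factors at \<open>i\<close> and
  \<open>Suc i\<close> in the product.\<close>

lemma integral_path_measure_pair:
  assumes "is_path_measure R x P" and "f \<in> C" "g \<in> C"
  shows "(LINT \<omega>|P. f (\<omega> i) * g (\<omega> (Suc i)))
    = chain R (replicate i (\<lambda>_. 1) @ [f, g]) x"
proof -
  let ?l = "replicate i (\<lambda>_. 1) @ [f, g]"
  have "(\<Prod>j<length ?l. (?l ! j) (\<omega> j)) = f (\<omega> i) * g (\<omega> (Suc i))" for \<omega>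
    by (simp add: nth_append)
  moreover have "set ?l \<subseteq> C"
    using assms(2,3) by (auto simp: C_def)
  ultimately show ?thesis
    using assms(1)[unfolded is_path_measure_def, THEN conjunct2, rule_format, of ?l] by simp
qed

text \<open>A nonempty tail enters \<open>chain\<close> only through its own chain, to which
  \<open>R\<close> is applied. So equalities need checking only without the padding by
  \<open>replicate\<close>.\<close>

lemma chain_replicate_cong:
  assumes "chain R (\<phi> # \<phi>s) = chain R (\<psi> # \<psi>s)"
  shows "chain R (replicate i \<eta> @ \<phi> # \<phi>s) = chain R (replicate i \<eta> @ \<psi> # \<psi>s)"
proof (induction i)
  case (Suc i)
  then show ?case
    \<comment> \<open>The recursion of \<open>chain\<close> matches on two leading entries; the
      second one is \<open>\<eta>\<close> or the head of the tail, depending on whether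
      \<open>i\<close> is positive.\<close>
    by (cases i) (use assms in auto)
qed (simp add: assms)

text \<open>The bound \<open>K\<close> gives integrability on a probability space. This matters
  because a non-integrable function has integral 0 by default.\<close>

lemma integral_eq_0_imp_AE_eq_0:
  fixes f :: "'a::topological_space \<Rightarrow> real"
  assumes "regular_borel_prob M" and "continuous_on UNIV f" and "\<And>x. 0 \<le> f x"
    and "\<And>x. f x \<le> K" and "integral\<^sup>L M f = 0"
  shows "AE x in M. f x = 0"
proof -
  interpret prob_space M
    using assms(1) by (simp add: regular_borel_prob_def)
  have "f \<in> borel_measurable M"
    using assms(1,2) borel_measurable_continuous_onI measurable_cong_sets
    unfolding regular_borel_prob_def by blast
  then have "integrable M f"
    using assms(3,4) by (intro integrable_const_bound[of _ K]) auto
  then show ?thesis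
    using assms(3,5) by (simp add: integral_nonneg_eq_0_iff_AE)
qed

text \<open>The set where \<open>f\<close> is nonzero is open and null, hence disjoint from the
  support.\<close>

lemma mem_support_imp_eq_0:
  fixes f :: "'a::topological_space \<Rightarrow> real"
  assumes "sets M = sets borel" and "continuous_on UNIV f" and "AE x in M. f x = 0"
    and "y \<in> measure_support M"
  shows "f y = 0"
proof (rule ccontr)
  assume "f y \<noteq> 0"
  let ?U = "{x. f x \<noteq> 0}"
  have "open ?U"
    using assms(2) by (intro open_Collect_neq) auto
  then have "emeasure M ?U > 0"
    using assms(4) \<open>f y \<noteq> 0\<close> by (auto simp: measure_support_def)
  moreover have "emeasure M ?U = 0"
    using assms(3) \<open>open ?U\<close> assms(1) AE_iff_measurable[of ?U M "\<lambda>x. f x = 0"]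
    by (simp add: sets_eq_imp_space_eq[OF assms(1)])
  ultimately show False by simp
qed

theorem proposition3p11:
  fixes R :: "('a::t2_space \<Rightarrow> real) \<Rightarrow> ('a \<Rightarrow> real)"
    and P :: "'a \<Rightarrow> (nat \<Rightarrow> 'a) measure"
    and r :: "'a \<Rightarrow> 'a"
  assumes "compact (UNIV :: 'a set)"
    and "linear_operator R" and "positive_operator R" and "R (\<lambda>_. 1) = (\<lambda>_. 1)"
    and "\<And>x. is_path_measure R x (P x)"
    and "continuous_on UNIV r" and "surj r"
    and "\<And>\<phi> \<psi>. \<phi> \<in> C \<Longrightarrow> \<psi> \<in> C \<Longrightarrow> R (mult_op (\<phi> \<circ> r) \<psi>) = mult_op \<phi> (R \<psi>)"
  shows "\<forall>\<mu> \<Sigma>\<mu>. regular_borel_prob \<mu> \<and> is_induced_measure P \<mu> \<Sigma>\<mu>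
           \<longrightarrow> measure_support \<Sigma>\<mu> \<subseteq> Sol r"
proof (intro allI impI subsetI)
  fix \<mu> S \<omega>
  assume *: "regular_borel_prob \<mu> \<and> is_induced_measure P \<mu> S" and supp: "\<omega> \<in> measure_support S"
  have S: "regular_borel_prob S"
    using * by (simp add: is_induced_measure_def)
  have "r (\<omega> (Suc i)) = \<omega> i" for i
  proof (rule ccontr)
    assume "r (\<omega> (Suc i)) \<noteq> \<omega> i"
    then obtain \<phi> :: "'a \<Rightarrow> real" where cont: "continuous_on UNIV \<phi>"
        and sep: "\<phi> (r (\<omega> (Suc i))) \<noteq> \<phi> (\<omega> i)"
      using compact_t2_separating_function[OF assms(1)] by blast
    define \<phi>2 where "\<phi>2 = (\<lambda>y. (\<phi> y)\<^sup>2)"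
    have cont_r: "continuous_on UNIV (\<lambda>y. \<phi> (r y))"
      using continuous_on_compose2[OF cont assms(6)] by simp
    have in_C: "\<phi> \<in> C" "\<phi>2 \<in> C" "\<phi> \<circ> r \<in> C" "\<phi>2 \<circ> r \<in> C" "(\<lambda>_. 1) \<in> C"
      using cont cont_r by (auto simp: C_def \<phi>2_def o_def intro!: continuous_intros)
    \<comment> \<open>Take the constant 1 as second factor in the pull-out identity and use that
      \<open>R\<close> fixes it.\<close>
    have R_comp: "R (\<psi> \<circ> r) = \<psi>" if "\<psi> \<in> C" for \<psi>
      using assms(8)[OF that in_C(5)] by (simp add: mult_op_def assms(4) o_def)
    obtain K where K: "\<bar>\<phi> y\<bar> \<le> K" for y
      using compact_UNIV_continuous_bounded[OF assms(1) cont] by blast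
    define f where "f = (\<lambda>\<eta>::nat \<Rightarrow> 'a. (\<phi> (\<eta> i) - \<phi> (r (\<eta> (Suc i))))\<^sup>2)"
    have cont_f: "continuous_on UNIV f"
      unfolding f_def
      by (intro continuous_intros continuous_on_compose2[OF cont] continuous_on_compose2[OF cont_r]
          continuous_on_product_coordinates) auto
    have f_le: "f \<eta> \<le> (2 * K)\<^sup>2" for \<eta>
    proof -
      have "\<bar>\<phi> (\<eta> i) - \<phi> (r (\<eta> (Suc i)))\<bar> \<le> \<bar>2 * K\<bar>"
        using K[of "\<eta> i"] K[of "r (\<eta> (Suc i))"] by linarith
      then show ?thesis
        unfolding f_def by (rule power2_mono)
    qed
    have AE_P: "AE \<eta> in P x. f \<eta> = 0" for x
    proof (rule integral_eq_0_imp_AE_eq_0)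
      show reg: "regular_borel_prob (P x)"
        using assms(5) by (simp add: is_path_measure_def)
      interpret prob_space "P x"
        using reg by (simp add: regular_borel_prob_def)
      have int: "integrable (P x) (\<lambda>\<eta>. g (\<eta> i) * h (\<eta> (Suc i)))" if "g \<in> C" "h \<in> C" for g h
      proof -
        have gh: "continuous_on UNIV g" "continuous_on UNIV h"
          using that by (auto simp: C_def)
        obtain G where G: "\<bar>g y\<bar> \<le> G" for y
          using compact_UNIV_continuous_bounded[OF assms(1) gh(1)] by blast
        obtain H where H: "\<bar>h y\<bar> \<le> H" for y
          using compact_UNIV_continuous_bounded[OF assms(1) gh(2)] by blast
        have "continuous_on UNIV (\<lambda>\<eta>::nat \<Rightarrow> 'a. g (\<eta> i) * h (\<eta> (Suc i)))"
          by (intro continuous_intros continuous_on_compose2[OF gh(1)] continuous_on_compose2[OF gh(2)]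
              continuous_on_product_coordinates) auto
        then have "(\<lambda>\<eta>. g (\<eta> i) * h (\<eta> (Suc i))) \<in> borel_measurable (P x)"
          using reg borel_measurable_continuous_onI measurable_cong_sets
          unfolding regular_borel_prob_def by blast
        moreover have "\<bar>g (\<eta> i) * h (\<eta> (Suc i))\<bar> \<le> G * H" for \<eta>
          using G H by (simp add: abs_mult mult_mono')
        ultimately show ?thesis
          by (intro integrable_const_bound[of _ "G * H"]) auto
      qed
      \<comment> \<open>All three chains evaluate to \<open>\<phi>2\<close>: as
        \<open>\<phi>2\<close> times \<open>R\<close> of 1, as \<open>\<phi>\<close> times
        \<open>R (\<phi> \<circ> r)\<close>, and as 1 times
        \<open>R (\<phi>2 \<circ> r)\<close>.\<close>
      have chains: "chain R [\<phi>2, \<lambda>_. 1] = chain R [\<phi>, \<phi> \<circ> r]"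
          "chain R [\<lambda>_. 1, \<phi>2 \<circ> r] = chain R [\<phi>, \<phi> \<circ> r]"
        using R_comp[OF in_C(1)] R_comp[OF in_C(2)] assms(4)
        by (simp_all add: mult_op_def \<phi>2_def power2_eq_square o_def)
      let ?I = "\<lambda>g h. LINT \<eta>|P x. g (\<eta> i) * h (\<eta> (Suc i))"
      have "?I \<phi>2 (\<lambda>_. 1) = ?I \<phi> (\<phi> \<circ> r)" "?I (\<lambda>_. 1) (\<phi>2 \<circ> r) = ?I \<phi> (\<phi> \<circ> r)"
        unfolding integral_path_measure_pair[OF assms(5) in_C(1,3)]
          integral_path_measure_pair[OF assms(5) in_C(2,5)]
          integral_path_measure_pair[OF assms(5) in_C(5,4)]
          chain_replicate_cong[OF chains(1)] chain_replicate_cong[OF chains(2)]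
        by (rule refl)+
      \<comment> \<open>The factors 1 put each term of the expanded square into the two-factor form
        of \<open>?I\<close> and \<open>int\<close>; the integrals then cancel as 1 + 1 - 2.\<close>
      moreover have "f = (\<lambda>\<eta>. (\<phi>2 (\<eta> i) * 1 + 1 * (\<phi>2 \<circ> r) (\<eta> (Suc i)))
          - 2 * (\<phi> (\<eta> i) * (\<phi> \<circ> r) (\<eta> (Suc i))))"
        by (simp add: f_def \<phi>2_def power2_diff fun_eq_iff)
      ultimately show "integral\<^sup>L (P x) f = 0"
        using int[OF in_C(2,5)] int[OF in_C(5,4)] int[OF in_C(1,3)] by simp
    qed (use cont_f f_le in \<open>auto simp: f_def\<close>)
    \<comment> \<open>Restricting to the fibre multiplies \<open>f\<close> by an indicator, which
      keeps it zero almost everywhere. The outer integrand over \<open>\<mu>\<close> is thus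
      identically 0.\<close>
    have "(LINT \<eta>:{\<eta>. \<eta> 0 = x}|P x. f \<eta>) = 0" for x
      unfolding set_lebesgue_integral_def
      by (rule integral_eq_zero_AE, rule eventually_mono[OF AE_P]) simp
    then have "integral\<^sup>L S f = 0"
      using * cont_f by (simp add: is_induced_measure_def C_def)
    then have "AE \<eta> in S. f \<eta> = 0"
      using integral_eq_0_imp_AE_eq_0[OF S cont_f _ f_le] by (simp add: f_def)
    then have "f \<omega> = 0"
      using mem_support_imp_eq_0[OF _ cont_f _ supp] S by (simp add: regular_borel_prob_def)
    then show False
      using sep by (simp add: f_def)
  qed
  then show "\<omega> \<in> Sol r"
    by (simp add: Sol_def)
qed

end
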